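(* Let $\check\lambda_G\in\check\Lambda_{G,G}$. Then there exists a smallest standard parabolic subgroup $P=P_{\check\lambda_G}$ of $G$ with the property that there exists $\check\lambda_P\in\check\Lambda_{G,P}$ satisfying $$\phi_G(\check\lambda_G)=\phi_P(\check\lambda_P)\qquad\text{and}\qquad \pi(\check\lambda_P)=\check\lambda_G,$$ where $\pi:\check\Lambda_{G,P}\to\check\Lambda_{G,G}$ is the natural projection. This parabolic subgroup is the one given by the set of simple roots (of its Levi) $$\mathcal I_{\check\lambda_G}:=\{i\in\mathcal I\mid \langle\phi_G(\check\lambda_G)-\check\lambda,\omega_i\rangle\notin\mathbb Z\},$$ where $\check\lambda\in\check\Lambda_G$ is a lift of $\check\lambda_G$. Moreover, the degree $\check\lambda_P$ is unique.
   Context: Let $k$ be an algebraically closed field of characteristic $0$ and $G$ a (connected) reductive group over $k$ with fixed maximal torus and Borel subgroup $T\subset B\subset G$. Let $\Lambda_G=\mathrm{Hom}(T,\mathbb G_m)$, $\check\Lambda_G=\mathrm{Hom}(\mathbb G_m,T)$, with pairing $\langle\cdot,\cdot\rangle$, and let $\alpha_i$, $\check\alpha_i$ ($i\in\mathcal I$) be the simple roots and simple coroots. Standard parabolics $P\supset B$ correspond to subsets $\mathcal I_P\subset\mathcal I$, where $\mathcal I_P$ is the set of simple roots of the Levi $M\supset T$ of $P$. Put $\check\Lambda_{G,P}=\check\Lambda_G/\mathrm{span}_{\mathbb Z}\{\check\alpha_i: i\in\mathcal I_P\}$ (in particular $\check\Lambda_{G,G}=\check\Lambda_G/\mathrm{span}_{\mathbb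 Z}\{\check\alpha_i: i\in\mathcal I\}$); elements of these groups are called degrees. A superscript $\mathbb Q$ means $\otimes_{\mathbb Z}\mathbb Q$. The fundamental weights $\omega_i\in\Lambda_G^{\mathbb Q}$ ($i\in\mathcal I$) are fixed elements with $\langle\check\alpha_j,\omega_i\rangle=\delta_{ij}$ (since $\phi_G(\check\lambda_G)-\check\lambda$ lies in the $\mathbb Q$-span of the coroots, its pairing with $\omega_i$ does not depend on the choice). Slope map: with $\check\Lambda_{Z(M)}$ the cocharacters of the center of $M$, the composition $\check\Lambda_{Z(M)}^{\mathbb Q}\hookrightarrow\check\Lambda_G^{\mathbb Q}\to\check\Lambda_{G,P}^{\mathbb Q}$ is an isomorphism, and $\phi_P$ is the composition $\check\Lambda_{G,P}\to\check\Lambda_{G,P}^{\mathbb Q}\simeq\check\Lambda_{Z(M)}^{\mathbb Q}\hookrightarrow\check\Lambda_G^{\mathbb Q}$ (for $P=G$ this is $\phi_G$). *)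

theory Defs
  imports Complex_Main "HOL-Library.Set_Algebras"
begin

text \<open>
  A connected reductive group \<open>G \<supseteq> B \<supseteq> T\<close> over an algebraically closed field of characteristic \<open>0\<close>
  is represented by its based root datum. The rational spaces \<open>\<Lambda>\<^sub>G \<otimes> \<rat>\<close> and \<open>\<Lambda>\<^sup>\<or>\<^sub>G \<otimes> \<rat>\<close> are types,
  and \<open>\<Lambda>\<^sub>G\<close>, \<open>\<Lambda>\<^sup>\<or>\<^sub>G\<close> are full lattices in them; every finitely generated free abelian group \<open>L\<close>
  sits in \<open>L \<otimes> \<rat>\<close> in this way.
\<close>

class rat_vector = ab_group_add +
  fixes scaleQ :: "rat \<Rightarrow> 'a \<Rightarrow> 'a"  (infixr "*\<^sub>Q" 75)
  assumes scaleQ_right_distrib: "a *\<^sub>Q (x + y) = a *\<^sub>Q x + a *\<^sub>Q y"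
    and scaleQ_left_distrib: "(a + b) *\<^sub>Q x = a *\<^sub>Q x + b *\<^sub>Q x"
    and scaleQ_scaleQ: "a *\<^sub>Q (b *\<^sub>Q x) = (a * b) *\<^sub>Q x"
    and scaleQ_one: "1 *\<^sub>Q x = x"

global_interpretation over_rat: vector_space "scaleQ :: rat \<Rightarrow> 'a \<Rightarrow> 'a::rat_vector"
  by unfold_locales
    (simp_all add: scaleQ_right_distrib scaleQ_left_distrib scaleQ_scaleQ scaleQ_one)

global_interpretation over_int: module "\<lambda>n::int. scaleQ (of_int n) :: 'a \<Rightarrow> 'a::rat_vector"
  by unfold_locales
    (simp_all add: scaleQ_right_distrib scaleQ_left_distrib scaleQ_scaleQ scaleQ_one)

definition full_lattice :: "'a::rat_vector set \<Rightarrow> bool" where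
  "full_lattice L \<longleftrightarrow> (\<exists>B. finite B \<and> over_rat.independent B \<and> over_rat.span B = UNIV \<and>
     L = over_int.span B)"

record ('x, 'y, 'i) root_datum =
  chars :: "'x set"
  cochars :: "'y set"
  pairing :: "'y \<Rightarrow> 'x \<Rightarrow> rat"
  roots :: "'x set"
  coroot :: "'x \<Rightarrow> 'y"
  simple_ix :: "'i set"
  simple_root :: "'i \<Rightarrow> 'x"

definition simple_coroot :: "('x, 'y, 'i) root_datum \<Rightarrow> 'i \<Rightarrow> 'y" where
  "simple_coroot D i = coroot D (simple_root D i)"

definition positive_roots :: "('x::rat_vector, 'y, 'i) root_datum \<Rightarrow> 'x set" where
  "positive_roots D =
     {\<beta> \<in> roots D. \<exists>c :: 'i \<Rightarrow> nat. \<beta> = (\<Sum>i\<in>simple_ix D. of_nat (c i) *\<^sub>Q simple_root D i)}"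

text \<open>
  Perfectness of the pairing between \<open>\<Lambda>\<^sup>\<or>\<^sub>G\<close> and \<open>\<Lambda>\<^sub>G\<close> is expressed by saying that each lattice is the
  dual of the other. The Borel subgroup \<open>B\<close> is the choice of the base \<open>\<alpha>\<^sub>i\<close>.
\<close>

locale based_root_datum =
  fixes D :: "('x::rat_vector, 'y::rat_vector, 'i) root_datum"
  assumes full_lattice_chars: "full_lattice (chars D)"
    and full_lattice_cochars: "full_lattice (cochars D)"
    and linear_pairing_left: "Vector_Spaces.linear scaleQ (*) (\<lambda>y. pairing D y x)"
    and linear_pairing_right: "Vector_Spaces.linear scaleQ (*) (\<lambda>x. pairing D y x)"
    and chars_dual: "x \<in> chars D \<longleftrightarrow> (\<forall>y\<in>cochars D. pairing D y x \<in> \<int>)"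
    and cochars_dual: "y \<in> cochars D \<longleftrightarrow> (\<forall>x\<in>chars D. pairing D y x \<in> \<int>)"
    and finite_roots: "finite (roots D)"
    and roots_subset: "roots D \<subseteq> chars D"
    and coroot_in_cochars: "\<alpha> \<in> roots D \<Longrightarrow> coroot D \<alpha> \<in> cochars D"
    and inj_on_coroot: "inj_on (coroot D) (roots D)"
    and pairing_coroot_root: "\<alpha> \<in> roots D \<Longrightarrow> pairing D (coroot D \<alpha>) \<alpha> = 2"
    and reflection_root:
      "\<alpha> \<in> roots D \<Longrightarrow> \<beta> \<in> roots D \<Longrightarrow> \<beta> - pairing D (coroot D \<alpha>) \<beta> *\<^sub>Q \<alpha> \<in> roots D"
    and reflection_coroot:
      "\<alpha> \<in> roots D \<Longrightarrow> \<beta> \<in> roots D \<Longrightarrow>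
       coroot D \<beta> - pairing D (coroot D \<beta>) \<alpha> *\<^sub>Q coroot D \<alpha> \<in> coroot D ` roots D"
    and reduced: "\<alpha> \<in> roots D \<Longrightarrow> c *\<^sub>Q \<alpha> \<in> roots D \<Longrightarrow> c = 1 \<or> c = -1"
    and finite_simple_ix: "finite (simple_ix D)"
    and simple_root_in_roots: "i \<in> simple_ix D \<Longrightarrow> simple_root D i \<in> roots D"
    and inj_on_simple_root: "inj_on (simple_root D) (simple_ix D)"
    and independent_simple_roots: "over_rat.independent (simple_root D ` simple_ix D)"
    and positive_or_negative:
      "\<beta> \<in> roots D \<Longrightarrow> \<beta> \<in> positive_roots D \<or> - \<beta> \<in> positive_roots D"

text \<open>
  A standard parabolic subgroup \<open>P \<supseteq> B\<close> is represented by its set of roots with respect to \<open>T\<close>, so that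
  inclusion of subgroups is inclusion of root sets and \<open>G\<close> itself is \<^term>\<open>roots D\<close>. The sets that
  occur are the closed sets of roots containing the positive roots (parabolic subsets). The Levi
  subgroup \<open>M \<supseteq> T\<close> of \<open>P\<close> has as roots those \<open>\<alpha>\<close> with \<open>\<plusminus>\<alpha>\<close> both roots of \<open>P\<close>.
\<close>

definition standard_parabolic :: "('x::rat_vector, 'y, 'i) root_datum \<Rightarrow> 'x set \<Rightarrow> bool" where
  "standard_parabolic D P \<longleftrightarrow> positive_roots D \<subseteq> P \<and> P \<subseteq> roots D \<and>
     (\<forall>\<alpha>\<in>P. \<forall>\<beta>\<in>P. \<alpha> + \<beta> \<in> roots D \<longrightarrow> \<alpha> + \<beta> \<in> P)"

definition levi_roots :: "'x::rat_vector set \<Rightarrow> 'x set" where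
  "levi_roots P = {\<alpha> \<in> P. - \<alpha> \<in> P}"

definition levi_simple_ix :: "('x::rat_vector, 'y, 'i) root_datum \<Rightarrow> 'x set \<Rightarrow> 'i set" where
  "levi_simple_ix D P = {i \<in> simple_ix D. simple_root D i \<in> levi_roots P}"

text \<open>
  The center of \<open>M\<close> is the intersection in \<open>T\<close> of the kernels of the roots of \<open>M\<close>, and for a cocharacter
  \<open>\<lambda>\<close> of \<open>T\<close> the composition \<open>\<alpha> \<circ> \<lambda>\<close> is \<open>z \<mapsto> z\<^bsup>\<langle>\<lambda>,\<alpha>\<rangle>\<^esup>\<close>.
\<close>

definition center_cochars ::
    "('x::rat_vector, 'y::rat_vector, 'i) root_datum \<Rightarrow> 'x set \<Rightarrow> 'y set" where
  "center_cochars D P = {y \<in> cochars D. \<forall>\<alpha>\<in>levi_roots P. pairing D y \<alpha> = 0}"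

definition levi_coroot_lattice ::
    "('x::rat_vector, 'y::rat_vector, 'i) root_datum \<Rightarrow> 'x set \<Rightarrow> 'y set" where
  "levi_coroot_lattice D P = over_int.span (simple_coroot D ` levi_simple_ix D P)"

definition levi_coroot_space ::
    "('x::rat_vector, 'y::rat_vector, 'i) root_datum \<Rightarrow> 'x set \<Rightarrow> 'y set" where
  "levi_coroot_space D P = over_rat.span (simple_coroot D ` levi_simple_ix D P)"

text \<open>
  Elements of a quotient are cosets: \<open>y +o H\<close> is the class of \<open>y\<close> modulo \<open>H\<close>, and for \<open>H \<subseteq> K\<close> the
  natural map from cosets of \<open>H\<close> to cosets of \<open>K\<close> is \<open>C \<mapsto> C + K\<close>. The group \<open>\<Lambda>\<^sup>\<or>\<^bsub>G,P\<^esub>\<close> is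
  \<open>degrees D P\<close>, and the map \<open>\<Lambda>\<^sup>\<or>\<^bsub>G,P\<^esub> \<rightarrow> \<Lambda>\<^sup>\<or>\<^bsub>G,G\<^esub>\<close> is \<open>degree_proj D\<close>.
\<close>

definition degree_class ::
    "('x::rat_vector, 'y::rat_vector, 'i) root_datum \<Rightarrow> 'x set \<Rightarrow> 'y \<Rightarrow> 'y set" where
  "degree_class D P y = y +o levi_coroot_lattice D P"

definition degrees ::
    "('x::rat_vector, 'y::rat_vector, 'i) root_datum \<Rightarrow> 'x set \<Rightarrow> 'y set set" where
  "degrees D P = degree_class D P ` cochars D"

definition degree_proj ::
    "('x::rat_vector, 'y::rat_vector, 'i) root_datum \<Rightarrow> 'y set \<Rightarrow> 'y set" where
  "degree_proj D C = C + levi_coroot_lattice D (roots D)"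

text \<open>
  By right exactness, \<open>\<Lambda>\<^sup>\<or>\<^bsub>G,P\<^esub> \<otimes> \<rat>\<close> is \<open>\<Lambda>\<^sup>\<or>\<^sub>G \<otimes> \<rat>\<close> modulo \<open>levi_coroot_space D P\<close>, and
  \<open>C \<mapsto> C + levi_coroot_space D P\<close> is the map \<open>\<Lambda>\<^sup>\<or>\<^bsub>G,P\<^esub> \<rightarrow> \<Lambda>\<^sup>\<or>\<^bsub>G,P\<^esub> \<otimes> \<rat>\<close>. The slope map inverts the isomorphism from
  \<open>\<Lambda>\<^sup>\<or>\<^bsub>Z(M)\<^esub> \<otimes> \<rat>\<close> to this quotient.
\<close>

definition slope ::
    "('x::rat_vector, 'y::rat_vector, 'i) root_datum \<Rightarrow> 'x set \<Rightarrow> 'y set \<Rightarrow> 'y" where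
  "slope D P C =
     inv_into (over_rat.span (center_cochars D P)) (\<lambda>v. v +o levi_coroot_space D P)
       (C + levi_coroot_space D P)"

end

theory Submission
  imports Defs
begin

text \<open>
  Let \<open>\<nu>\<close> lift the given degree and let \<open>\<phi>\<close> be its slope. For a standard parabolic \<open>P\<close>, a degree with the
  required properties amounts to a splitting of \<open>\<phi> - \<nu>\<close> into a rational combination of the simple coroots
  of the Levi and an integral combination of all simple coroots. In the coordinates \<open>\<langle>\<cdot>, \<omega>\<^sub>i\<rangle>\<close> this is possible
  iff all nonintegral coordinates belong to the Levi, and then the integral summand is unique modulo
  the coroot lattice of the Levi. The root-theoretic input is that the Cartan matrix of a Levi is
  nondegenerate and that the roots of a Levi are combinations of its simple roots; both
  come from the form \<open>\<Sum>\<^sub>\<gamma> \<langle>y, \<gamma>\<rangle>\<langle>z, \<gamma>\<rangle>\<close> over all roots, which is invariant under the Weyl group.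
\<close>

section \<open>Modules, lattices and cosets\<close>

text \<open>Coefficients are indexed by \<open>K\<close> instead of by the image, so repeated values
  of \<open>f\<close> cause no trouble. The module setting serves both the rational and the integral
  spans of simple coroots.\<close>

lemma (in module) span_image_finite:
  assumes "finite K"
  shows "span (f ` K) = range (\<lambda>c. \<Sum>k\<in>K. c k *s f k)"
proof
  have "subspace (range (\<lambda>c. \<Sum>k\<in>K. c k *s f k))"
  proof (rule subspaceI)
    show "0 \<in> range (\<lambda>c. \<Sum>k\<in>K. c k *s f k)"
      by (rule range_eqI[where x = "\<lambda>_. 0"]) simp
  next
    fix x y
    assume "x \<in> range (\<lambda>c. \<Sum>k\<in>K. c k *s f k)" "y \<in> range (\<lambda>c. \<Sum>k\<in>K. c k *s f k)"
    then obtain c d where "x = (\<Sum>k\<in>K. c k *s f k)" "y = (\<Sum>k\<in>K. d k *s f k)"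
      by auto
    then show "x + y \<in> range (\<lambda>c. \<Sum>k\<in>K. c k *s f k)"
      by (intro range_eqI[where x = "\<lambda>k. c k + d k"]) (simp add: scale_left_distrib sum.distrib)
  next
    fix a x
    assume "x \<in> range (\<lambda>c. \<Sum>k\<in>K. c k *s f k)"
    then obtain c where "x = (\<Sum>k\<in>K. c k *s f k)"
      by auto
    then show "a *s x \<in> range (\<lambda>c. \<Sum>k\<in>K. c k *s f k)"
      by (intro range_eqI[where x = "\<lambda>k. a * c k"]) (simp add: scale_sum_right)
  qed
  moreover have "f ` K \<subseteq> range (\<lambda>c. \<Sum>k\<in>K. c k *s f k)"
  proof
    fix x
    assume "x \<in> f ` K"
    then obtain j where "j \<in> K" "x = f j"
      by auto
    moreover have "(\<Sum>k\<in>K. (if k = j then 1 else 0) *s f k) = (\<Sum>k\<in>K. if k = j then f k else 0)"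
      by (rule sum.cong) auto
    ultimately show "x \<in> range (\<lambda>c. \<Sum>k\<in>K. c k *s f k)"
      using assms by (intro range_eqI[where x = "\<lambda>k. if k = j then 1 else 0"]) simp
  qed
  ultimately show "span (f ` K) \<subseteq> range (\<lambda>c. \<Sum>k\<in>K. c k *s f k)"
    by (rule span_minimal[rotated])
  show "range (\<lambda>c. \<Sum>k\<in>K. c k *s f k) \<subseteq> span (f ` K)"
    by (auto intro!: span_sum intro: span_scale span_base)
qed

lemma int_subspace_if_rat_subspace:
  "over_rat.subspace V \<Longrightarrow> over_int.subspace V"
  by (auto simp: over_rat.subspace_def over_int.subspace_def)

lemma int_span_subset_rat_span: "over_int.span S \<subseteq> over_rat.span S"
  by (intro over_int.span_minimal int_subspace_if_rat_subspace over_rat.span_superset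
      over_rat.subspace_span)

text \<open>Denominators can be cleared: the vectors with a nonzero integral multiple in
  \<open>L\<close> form a rational subspace, and it contains a basis.\<close>

lemma full_lattice_multiple:
  assumes "full_lattice L"
  obtains N :: rat where "N \<noteq> 0" "N *\<^sub>Q y \<in> L"
proof -
  obtain B where B: "over_rat.span B = UNIV" "L = over_int.span B"
    using assms by (auto simp: full_lattice_def)
  have "over_rat.subspace {y. \<exists>N::int. N \<noteq> 0 \<and> of_int N *\<^sub>Q y \<in> L}"
  proof (rule over_rat.subspaceI)
    show "0 \<in> {y. \<exists>N::int. N \<noteq> 0 \<and> of_int N *\<^sub>Q y \<in> L}"
      by (auto simp: B over_int.span_zero intro: exI[where x = 1])
  next
    fix x y
    assume "x \<in> {y. \<exists>N::int. N \<noteq> 0 \<and> of_int N *\<^sub>Q y \<in> L}"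
      "y \<in> {y. \<exists>N::int. N \<noteq> 0 \<and> of_int N *\<^sub>Q y \<in> L}"
    then obtain M N :: int where MN: "M \<noteq> 0" "of_int M *\<^sub>Q x \<in> L" "N \<noteq> 0" "of_int N *\<^sub>Q y \<in> L"
      by auto
    have "of_int N *\<^sub>Q of_int M *\<^sub>Q x + of_int M *\<^sub>Q of_int N *\<^sub>Q y \<in> L"
      using MN over_int.span_add over_int.span_scale unfolding B(2) by blast
    then have "of_int (M * N) *\<^sub>Q (x + y) \<in> L"
      by (simp add: scaleQ_right_distrib mult.commute)
    with MN show "x + y \<in> {y. \<exists>N::int. N \<noteq> 0 \<and> of_int N *\<^sub>Q y \<in> L}"
      by (auto intro!: exI[where x = "M * N"])
  next
    fix q :: rat and x
    assume "x \<in> {y. \<exists>N::int. N \<noteq> 0 \<and> of_int N *\<^sub>Q y \<in> L}"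
    then obtain N :: int where N: "N \<noteq> 0" "of_int N *\<^sub>Q x \<in> L"
      by auto
    obtain a b :: int where q: "q = of_int a / of_int b" "b \<noteq> 0"
      using quotient_of_div[of q] quotient_of_denom_pos[of q] by (cases "quotient_of q") auto
    have "of_int a *\<^sub>Q of_int N *\<^sub>Q x \<in> L"
      using N over_int.span_scale unfolding B(2) by blast
    then have "of_int (b * N) *\<^sub>Q (q *\<^sub>Q x) \<in> L"
      using q by (simp add: mult.commute)
    with N q show "q *\<^sub>Q x \<in> {y. \<exists>N::int. N \<noteq> 0 \<and> of_int N *\<^sub>Q y \<in> L}"
      by (auto intro!: exI[where x = "b * N"])
  qed
  moreover have "B \<subseteq> {y. \<exists>N::int. N \<noteq> 0 \<and> of_int N *\<^sub>Q y \<in> L}"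
    by (auto simp: B over_int.span_base intro!: exI[where x = 1])
  ultimately have "over_rat.span B \<subseteq> {y. \<exists>N::int. N \<noteq> 0 \<and> of_int N *\<^sub>Q y \<in> L}"
    by (rule over_rat.span_minimal[rotated])
  then have "y \<in> {y. \<exists>N::int. N \<noteq> 0 \<and> of_int N *\<^sub>Q y \<in> L}"
    unfolding B by blast
  then obtain N :: int where "N \<noteq> 0" "of_int N *\<^sub>Q y \<in> L"
    by auto
  then show ?thesis
    using that[of "of_int N"] by simp
qed

text \<open>Lattice vectors have integral coordinates in a basis of the lattice, whereas a nonzero
  coordinate can be rescaled to any rational number.\<close>

lemma full_lattice_divisible_zero:
  assumes "full_lattice L" and x: "\<And>q. q *\<^sub>Q x \<in> L"
  shows "x = 0"
proof -
  obtain B where B: "over_rat.independent B" "over_rat.span B = UNIV" "L = over_int.span B"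
    using assms(1) by (auto simp: full_lattice_def)
  have "over_int.subspace {y. \<forall>b. over_rat.representation B y b \<in> \<int>}"
    using B by (auto intro!: over_int.subspaceI
        simp: over_rat.representation_add over_rat.representation_scale over_rat.representation_zero)
  moreover have "B \<subseteq> {y. \<forall>b. over_rat.representation B y b \<in> \<int>}"
    using B by (auto simp: over_rat.representation_basis)
  ultimately have L: "L \<subseteq> {y. \<forall>b. over_rat.representation B y b \<in> \<int>}"
    unfolding B by (rule over_int.span_minimal[rotated])
  have "over_rat.representation B x b = 0" for b
  proof (rule ccontr)
    assume r: "over_rat.representation B x b \<noteq> 0"
    \<comment> \<open>This multiple of \<open>x\<close> has the coordinate 1/2 at
      \<open>b\<close>.\<close>
    have "over_rat.representation B ((1 / (2 * over_rat.representation B x b)) *\<^sub>Q x) b \<in> \<int>"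
      using L x by blast
    then have "(1 / 2 :: rat) \<in> \<int>"
      using B r by (simp add: over_rat.representation_scale)
    then obtain n :: int where "1 / 2 = (of_int n :: rat)"
      by (auto elim: Ints_cases)
    then have "(of_int (2 * n) :: rat) = of_int 1"
      by simp
    then show False
      by (simp only: of_int_eq_iff) presburger
  qed
  then have "(\<Sum>b | over_rat.representation B x b \<noteq> 0. over_rat.representation B x b *\<^sub>Q b) = 0"
    by simp
  then show "x = 0"
    using over_rat.sum_nonzero_representation_eq[of B x] B by simp
qed

lemma coset_eq_iff:
  assumes "over_int.subspace H"
  shows "y +o H = z +o H \<longleftrightarrow> y - z \<in> H"
proof
  assume "y +o H = z +o H"
  moreover have "y \<in> y +o H"
    using over_int.subspace_0[OF assms] by (auto simp: elt_set_plus_def)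
  ultimately show "y - z \<in> H"
    by (auto simp: elt_set_plus_def)
next
  assume yz: "y - z \<in> H"
  then have zy: "z - y \<in> H"
    using over_int.subspace_neg[OF assms] by fastforce
  show "y +o H = z +o H"
  proof (intro equalityI subsetI)
    fix x
    assume "x \<in> y +o H"
    then obtain h where h: "h \<in> H" "x = y + h"
      by (auto simp: elt_set_plus_def)
    have "h + (y - z) \<in> H" "x = z + (h + (y - z))"
      using h yz over_int.subspace_add[OF assms] by auto
    then show "x \<in> z +o H"
      unfolding elt_set_plus_def by blast
  next
    fix x
    assume "x \<in> z +o H"
    then obtain h where h: "h \<in> H" "x = z + h"
      by (auto simp: elt_set_plus_def)
    have "h + (z - y) \<in> H" "x = y + (h + (z - y))"
      using h zy over_int.subspace_add[OF assms] by auto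
    then show "x \<in> y +o H"
      unfolding elt_set_plus_def by blast
  qed
qed

text \<open>Describes the natural map between quotients on representatives; it serves both
  \<open>degree_proj\<close> and the passage to the rational quotient in
  \<open>slope\<close>.\<close>

lemma coset_plus_subspace:
  assumes "over_int.subspace H" "over_int.subspace K" "H \<subseteq> K"
  shows "(y +o H) + K = y +o K"
proof -
  have "H + K = K"
  proof
    show "H + K \<subseteq> K"
      using assms over_int.subspace_add[OF assms(2)] by (auto simp: set_plus_def)
    show "K \<subseteq> H + K"
      using over_int.subspace_0[OF assms(1)] by (force simp: set_plus_def)
  qed
  then show ?thesis
    by (simp add: set_plus_rearrange3)
qed

section \<open>The Weyl-invariant form\<close>

context based_root_datum
begin

lemmas pairing_left_hom = linear_pairing_left[folded module_hom_iff_linear]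
lemmas pairing_right_hom = linear_pairing_right[folded module_hom_iff_linear]

lemmas pairing_left = module_hom.add[OF pairing_left_hom] module_hom.scale[OF pairing_left_hom]
  module_hom.zero[OF pairing_left_hom] module_hom.neg[OF pairing_left_hom]
  module_hom.diff[OF pairing_left_hom] module_hom.sum[OF pairing_left_hom]

lemmas pairing_right = module_hom.add[OF pairing_right_hom] module_hom.scale[OF pairing_right_hom]
  module_hom.zero[OF pairing_right_hom] module_hom.neg[OF pairing_right_hom]
  module_hom.diff[OF pairing_right_hom] module_hom.sum[OF pairing_right_hom]

text \<open>Every rational multiple of such an \<open>x\<close> still pairs integrally with
  \<open>cochars D\<close>, so by duality it lies in the lattice \<open>chars D\<close>.\<close>

lemma pairing_nondegenerate:
  assumes "\<And>y. pairing D y x = 0"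
  shows "x = 0"
  using full_lattice_chars
proof (rule full_lattice_divisible_zero)
  fix q
  show "q *\<^sub>Q x \<in> chars D"
    by (simp add: chars_dual pairing_right assms)
qed

lemma pairing_coroot_Ints:
  "\<alpha> \<in> roots D \<Longrightarrow> \<beta> \<in> roots D \<Longrightarrow> pairing D (coroot D \<alpha>) \<beta> \<in> \<int>"
  using coroot_in_cochars chars_dual roots_subset by blast

text \<open>The reflection in \<alpha> sends \<alpha> itself to \<alpha> - 2\<alpha>.\<close>

lemma uminus_root: "\<alpha> \<in> roots D \<Longrightarrow> - \<alpha> \<in> roots D"
proof -
  assume \<alpha>: "\<alpha> \<in> roots D"
  have "2 *\<^sub>Q \<alpha> = \<alpha> + \<alpha>"
    using scaleQ_left_distrib[of 1 1 \<alpha>] by (simp add: scaleQ_one)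
  then show ?thesis
    using reflection_root[OF \<alpha> \<alpha>] \<alpha> by (simp add: pairing_coroot_root)
qed

text \<open>An analogue of the Killing form on cocharacters. As a sum of squares it is positive
  semidefinite only: its radical consists of the vectors orthogonal to all roots, that is, the
  central directions.\<close>

definition form :: "'y \<Rightarrow> 'y \<Rightarrow> rat" where
  "form y z = (\<Sum>\<gamma>\<in>roots D. pairing D y \<gamma> * pairing D z \<gamma>)"

lemma form_add_left: "form (y + y') z = form y z + form y' z"
  by (simp add: form_def pairing_left algebra_simps sum.distrib)

lemma form_scale_left: "form (c *\<^sub>Q y) z = c * form y z"
  by (simp add: form_def pairing_left algebra_simps sum_distrib_left)

lemma form_commute: "form y z = form z y"
  by (simp add: form_def mult.commute)

lemma form_sum_left: "form (\<Sum>k\<in>K. c k *\<^sub>Q f k) z = (\<Sum>k\<in>K. c k * form (f k) z)"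
  by (induction K rule: infinite_finite_induct)
    (simp_all add: form_add_left form_scale_left, simp_all add: form_def pairing_left)

lemma form_nonneg: "form y y \<ge> 0"
  by (auto simp: form_def intro: sum_nonneg)

lemma form_zero_pairing_root: "form y y = 0 \<Longrightarrow> \<gamma> \<in> roots D \<Longrightarrow> pairing D y \<gamma> = 0"
  using finite_roots by (auto simp: form_def sum_nonneg_eq_0_iff)

text \<open>A coroot pairs to 2 with its own root, so it lies outside the radical.\<close>

lemma form_coroot_pos:
  assumes "\<alpha> \<in> roots D"
  shows "form (coroot D \<alpha>) (coroot D \<alpha>) > 0"
  using form_nonneg form_zero_pairing_root[OF _ assms] pairing_coroot_root[OF assms]
  by (metis less_eq_rat_def zero_neq_numeral)

text \<open>The reflection of cocharacters is adjoint to the reflection \<open>s\<close> of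
  characters, and \<open>s\<close> is an involution permuting the roots, so the sum is merely
  reindexed.\<close>

lemma form_reflection:
  assumes "\<alpha> \<in> roots D"
  shows "form (y - pairing D y \<alpha> *\<^sub>Q coroot D \<alpha>) (z - pairing D z \<alpha> *\<^sub>Q coroot D \<alpha>) = form y z"
proof -
  define s where "s = (\<lambda>\<gamma>. \<gamma> - pairing D (coroot D \<alpha>) \<gamma> *\<^sub>Q \<alpha>)"
  have pair: "pairing D (y - pairing D y \<alpha> *\<^sub>Q coroot D \<alpha>) \<gamma> = pairing D y (s \<gamma>)" for y \<gamma>
    by (simp add: s_def pairing_left pairing_right)
  have "s (s \<gamma>) = \<gamma>" for \<gamma>
    using pairing_coroot_root[OF assms]
    by (simp add: s_def pairing_right over_rat.scale_left_diff_distrib over_rat.scale_right_diff_distrib)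
  moreover have "s \<gamma> \<in> roots D" if "\<gamma> \<in> roots D" for \<gamma>
    using reflection_root[OF assms that] by (simp add: s_def)
  ultimately have "bij_betw s (roots D) (roots D)"
    by (intro bij_betw_byWitness[where f' = s]) auto
  then show ?thesis
    unfolding form_def pair by (rule sum.reindex_bij_betw)
qed

text \<open>Reflecting both arguments preserves the form and negates the coroot; expanding the
  reflected \<open>y\<close> and solving gives the formula. Up to a positive factor, the form thus
  identifies a coroot with its root.\<close>

lemma form_coroot:
  assumes "\<alpha> \<in> roots D"
  shows "form (coroot D \<alpha>) y = form (coroot D \<alpha>) (coroot D \<alpha>) / 2 * pairing D y \<alpha>"
proof -
  have "coroot D \<alpha> - pairing D (coroot D \<alpha>) \<alpha> *\<^sub>Q coroot D \<alpha> = (-1) *\<^sub>Q coroot D \<alpha>"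
    using scaleQ_left_distrib[of "1" 1 "coroot D \<alpha>"] pairing_coroot_root[OF assms]
    by (simp add: scaleQ_one)
  moreover have "form y z = form (y - pairing D y \<alpha> *\<^sub>Q coroot D \<alpha>) (z - pairing D z \<alpha> *\<^sub>Q coroot D \<alpha>)" for y z
    using form_reflection[OF assms] by simp
  ultimately have "form (coroot D \<alpha>) y = - form (coroot D \<alpha>) (y - pairing D y \<alpha> *\<^sub>Q coroot D \<alpha>)"
    by (metis form_scale_left mult_minus1)
  also have "\<dots> = - form (coroot D \<alpha>) y + pairing D y \<alpha> * form (coroot D \<alpha>) (coroot D \<alpha>)"
    by (simp add: form_def pairing_left algebra_simps sum_subtractf sum_distrib_left)
  finally show ?thesis
    by (simp add: field_simps)
qed

section \<open>Pairs of roots\<close>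

lemma pairing_coroot_symmetric:
  assumes "\<alpha> \<in> roots D" "\<beta> \<in> roots D"
  shows "form (coroot D \<alpha>) (coroot D \<alpha>) * pairing D (coroot D \<beta>) \<alpha>
    = form (coroot D \<beta>) (coroot D \<beta>) * pairing D (coroot D \<alpha>) \<beta>"
  \<comment> \<open>Both sides are twice the form of the two coroots.\<close>
  using form_coroot[OF assms(1), of "coroot D \<beta>"] form_coroot[OF assms(2), of "coroot D \<alpha>"]
    form_commute[of "coroot D \<alpha>" "coroot D \<beta>"] by simp

lemma pairing_coroot_pos_commute:
  assumes "\<alpha> \<in> roots D" "\<beta> \<in> roots D"
  shows "pairing D (coroot D \<alpha>) \<beta> > 0 \<longleftrightarrow> pairing D (coroot D \<beta>) \<alpha> > 0"
  using pairing_coroot_symmetric[OF assms] form_coroot_pos[OF assms(1)] form_coroot_pos[OF assms(2)]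
  by (metis zero_less_mult_pos zero_less_mult_iff)

text \<open>This is the Cauchy-Schwarz inequality for the two coroots: the component of one
  orthogonal to the other has nonnegative square length.\<close>

lemma pairing_coroot_mult_le_4:
  assumes "\<alpha> \<in> roots D" "\<beta> \<in> roots D"
  shows "pairing D (coroot D \<alpha>) \<beta> * pairing D (coroot D \<beta>) \<alpha> \<le> 4"
proof -
  let ?a = "form (coroot D \<alpha>) (coroot D \<alpha>)" and ?b = "form (coroot D \<beta>) (coroot D \<beta>)"
  let ?p = "pairing D (coroot D \<alpha>) \<beta>" and ?q = "pairing D (coroot D \<beta>) \<alpha>"
  \<comment> \<open>Since the coroot of \<alpha> pairs to 2 with \<alpha>, the coefficient
    \<open>- ?q / 2\<close> makes \<open>?v\<close> orthogonal to \<alpha>.\<close>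
  let ?v = "coroot D \<beta> + (- ?q / 2) *\<^sub>Q coroot D \<alpha>"
  have "form ?v ?v = form (coroot D \<beta>) ?v + (- ?q / 2) * form (coroot D \<alpha>) ?v"
    by (simp only: form_add_left form_scale_left)
  also have "form (coroot D \<alpha>) ?v = 0"
    using pairing_coroot_root[OF assms(1)] by (subst form_coroot) (simp_all add: assms pairing_left)
  also have "form (coroot D \<beta>) ?v = ?b / 2 * (2 - ?q / 2 * ?p)"
    using pairing_coroot_root[OF assms(2)] by (subst form_coroot) (simp_all add: assms pairing_left)
  finally have "0 \<le> ?b / 2 * (2 - ?q / 2 * ?p)"
    using form_nonneg[of ?v] by simp
  then have "0 \<le> 2 - ?q / 2 * ?p"
    using form_coroot_pos[OF assms(2)] by (simp add: zero_le_mult_iff)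
  then show ?thesis
    by (simp add: mult.commute)
qed

text \<open>
  The composition of the two reflections translates by a vector orthogonal to both coroots, so it
  would have infinite order if \<open>\<alpha> \<noteq> \<beta>\<close>.
\<close>

lemma root_eq_if_pairing_coroot_2:
  assumes \<alpha>: "\<alpha> \<in> roots D" and \<beta>: "\<beta> \<in> roots D"
    and p: "pairing D (coroot D \<alpha>) \<beta> = 2" and q: "pairing D (coroot D \<beta>) \<alpha> = 2"
  shows "\<alpha> = \<beta>"
proof (rule ccontr)
  assume "\<alpha> \<noteq> \<beta>"
  define v where "v = \<beta> - \<alpha>"
  have "v \<noteq> 0" and \<beta>_eq: "\<beta> = \<alpha> + v"
    using \<open>\<alpha> \<noteq> \<beta>\<close> by (auto simp: v_def)
  have two: "2 *\<^sub>Q x = x + x" for x :: 'x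
    using scaleQ_left_distrib[of 1 1 x] by (simp add: scaleQ_one)
  have v: "pairing D (coroot D \<alpha>) v = 0" "pairing D (coroot D \<beta>) v = 0"
    using p q \<alpha> \<beta> by (simp_all add: v_def pairing_right pairing_coroot_root)
  \<comment> \<open>The reflection in \<alpha> followed by that in \<beta> adds \<open>2 v\<close>,
    whence the even multiples.\<close>
  have "\<alpha> + of_nat (2 * n) *\<^sub>Q v \<in> roots D" for n
  proof (induction n)
    case 0
    then show ?case
      by (simp add: \<alpha>)
  next
    case (Suc n)
    have "- (- \<alpha> + of_nat (2 * n) *\<^sub>Q v) \<in> roots D"
      using reflection_root[OF \<alpha> Suc] \<alpha>
      by (intro uminus_root) (simp add: pairing_right v two pairing_coroot_root)
    from reflection_root[OF \<beta> this]
    have "- (- \<alpha> + of_nat (2 * n) *\<^sub>Q v) - 2 *\<^sub>Q \<beta> \<in> roots D"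
      by (simp add: pairing_right v q)
    from uminus_root[OF this] have "\<alpha> + of_nat (2 * n) *\<^sub>Q v + 2 *\<^sub>Q v \<in> roots D"
      by (simp add: \<beta>_eq two algebra_simps)
    then show ?case
      by (simp add: over_rat.scale_left_distrib algebra_simps)
  qed
  then have "range (\<lambda>n. \<alpha> + of_nat (2 * n) *\<^sub>Q v) \<subseteq> roots D"
    by auto
  moreover have "inj (\<lambda>n. \<alpha> + of_nat (2 * n) *\<^sub>Q v)"
    using \<open>v \<noteq> 0\<close> by (auto simp: inj_on_def)
  ultimately show False
    using finite_roots finite_subset infinite_iff_countable_subset by blast
qed

text \<open>Both mutual pairings are positive integers with product at most 4. If one of them is 1,
  a reflection yields the difference up to sign; otherwise both are 2, which is excluded because it
  would force \<alpha> = \<beta>.\<close>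

lemma root_diff:
  assumes \<alpha>: "\<alpha> \<in> roots D" and \<beta>: "\<beta> \<in> roots D" and "\<alpha> \<noteq> \<beta>"
    and pos: "pairing D (coroot D \<alpha>) \<beta> > 0"
  shows "\<beta> - \<alpha> \<in> roots D"
proof -
  obtain m n :: int where m: "pairing D (coroot D \<alpha>) \<beta> = of_int m"
    and n: "pairing D (coroot D \<beta>) \<alpha> = of_int n"
    using pairing_coroot_Ints[OF \<alpha> \<beta>] pairing_coroot_Ints[OF \<beta> \<alpha>] by (auto elim!: Ints_cases)
  have "m > 0" "n > 0"
    using pos pairing_coroot_pos_commute[OF \<alpha> \<beta>] by (simp_all add: m n)
  have "(of_int (m * n) :: rat) \<le> of_int 4"
    using pairing_coroot_mult_le_4[OF \<alpha> \<beta>] by (simp add: m n)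
  then have mn: "m * n \<le> 4"
    by (simp only: of_int_le_iff)
  have "m = 1 \<or> n = 1 \<or> (m = 2 \<and> n = 2)"
  proof (rule ccontr)
    assume c: "\<not> ?thesis"
    then have "m \<ge> 2" "n \<ge> 2" "m \<ge> 3 \<or> n \<ge> 3"
      using \<open>m > 0\<close> \<open>n > 0\<close> by auto
    then have "m * n \<ge> 6"
      using mult_mono[of 2 m 3 n] mult_mono[of 3 m 2 n] by auto
    with mn show False
      by simp
  qed
  then consider "m = 1" | "n = 1" | "m = 2" "n = 2"
    by blast
  then show ?thesis
  proof cases
    case 1
    then show ?thesis
      using reflection_root[OF \<alpha> \<beta>] by (simp add: m scaleQ_one)
  next
    case 2
    then have "\<alpha> - \<beta> \<in> roots D"
      using reflection_root[OF \<beta> \<alpha>] by (simp add: n scaleQ_one)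
    from uminus_root[OF this] show ?thesis
      by simp
  next
    case 3
    then show ?thesis
      using root_eq_if_pairing_coroot_2[OF \<alpha> \<beta>] \<open>\<alpha> \<noteq> \<beta>\<close> by (simp add: m n)
  qed
qed

section \<open>Simple roots and parabolics\<close>

lemma simple_root_expansion_unique:
  assumes "(\<Sum>i\<in>simple_ix D. c i *\<^sub>Q simple_root D i) = (\<Sum>i\<in>simple_ix D. d i *\<^sub>Q simple_root D i)"
    and "i \<in> simple_ix D"
  shows "c i = d i"
proof -
  \<comment> \<open>Independence concerns the set of simple roots, so coefficients are carried from
    indices to vectors along the inverse of \<open>simple_root D\<close>.\<close>
  let ?g = "\<lambda>x. (c - d) (the_inv_into (simple_ix D) (simple_root D) x)"
  have "(\<Sum>x\<in>simple_root D ` simple_ix D. ?g x *\<^sub>Q x)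
      = (\<Sum>i\<in>simple_ix D. (c i - d i) *\<^sub>Q simple_root D i)"
    using inj_on_simple_root by (subst sum.reindex) (simp_all add: the_inv_into_f_f)
  also have "\<dots> = 0"
    using assms(1) by (simp add: over_rat.scale_left_diff_distrib sum_subtractf)
  finally have "?g (simple_root D i) = 0"
    using over_rat.independentD[of "simple_root D ` simple_ix D" "simple_root D ` simple_ix D" ?g]
      independent_simple_roots finite_simple_ix assms(2) by simp
  then show ?thesis
    using inj_on_simple_root assms(2) by (simp add: the_inv_into_f_f)
qed

lemma simple_root_expansion:
  assumes "i \<in> simple_ix D"
  shows "(\<Sum>j\<in>simple_ix D. (if j = i then a else 0) *\<^sub>Q simple_root D j) = a *\<^sub>Q simple_root D i"
proof -
  have "(\<Sum>j\<in>simple_ix D. (if j = i then a else 0) *\<^sub>Q simple_root D j)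
      = (\<Sum>j\<in>simple_ix D. if j = i then a *\<^sub>Q simple_root D j else 0)"
    by (rule sum.cong) auto
  then show ?thesis
    using assms finite_simple_ix by simp
qed

lemma sum_root_expansion_diff:
  "(\<Sum>i\<in>simple_ix D. (c i - d i) *\<^sub>Q simple_root D i)
    = (\<Sum>i\<in>simple_ix D. c i *\<^sub>Q simple_root D i) - (\<Sum>i\<in>simple_ix D. d i *\<^sub>Q simple_root D i)"
  by (simp add: over_rat.scale_left_diff_distrib sum_subtractf)

lemma simple_root_positive: "i \<in> simple_ix D \<Longrightarrow> simple_root D i \<in> positive_roots D"
proof -
  assume i: "i \<in> simple_ix D"
  have "rat_of_nat (if j = i then 1 else 0) = (if j = i then 1 else 0)" for j
    by simp
  then show ?thesis
    unfolding positive_roots_def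
    using simple_root_expansion[OF i, of 1] simple_root_in_roots[OF i]
    by (auto intro!: exI[where x = "\<lambda>j. if j = i then 1 else 0"] simp: scaleQ_one simp del: of_nat_eq_iff)
qed

text \<open>The coroot of \<beta> pairs to 2 with \<beta>, so some term of the expanded pairing is
  positive. The corresponding simple root pairs positively with \<beta> and can be subtracted by
  \<open>root_diff\<close>.\<close>

lemma positive_root_diff_simple:
  assumes "\<beta> \<in> roots D" "\<beta> = (\<Sum>i\<in>simple_ix D. of_nat (c i) *\<^sub>Q simple_root D i)"
    and "\<beta> \<notin> simple_root D ` simple_ix D"
  obtains i where "i \<in> simple_ix D" "c i > 0" "\<beta> - simple_root D i \<in> roots D"
    "\<beta> - simple_root D i = (\<Sum>j\<in>simple_ix D. of_nat ((c(i := c i - 1)) j) *\<^sub>Q simple_root D j)"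
proof -
  have "(\<Sum>i\<in>simple_ix D. of_nat (c i) * pairing D (coroot D \<beta>) (simple_root D i))
      = pairing D (coroot D \<beta>) (\<Sum>i\<in>simple_ix D. of_nat (c i) *\<^sub>Q simple_root D i)"
    by (simp add: pairing_right)
  also have "\<dots> > 0"
    using pairing_coroot_root[OF assms(1)] by (simp flip: assms(2))
  finally obtain i where i: "i \<in> simple_ix D" "of_nat (c i) * pairing D (coroot D \<beta>) (simple_root D i) > 0"
    by (metis (no_types, lifting) linorder_not_less sum_nonpos)
  then have c: "c i > 0" and "pairing D (coroot D \<beta>) (simple_root D i) > 0"
    by (auto simp: zero_less_mult_iff)
  moreover have "simple_root D i \<noteq> \<beta>"
    using assms(3) i(1) by blast
  ultimately have "\<beta> - simple_root D i \<in> roots D"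
    using assms(1) simple_root_in_roots[OF i(1)] pairing_coroot_pos_commute by (intro root_diff) blast+
  moreover have "\<beta> - simple_root D i = (\<Sum>j\<in>simple_ix D. of_nat ((c(i := c i - 1)) j) *\<^sub>Q simple_root D j)"
  proof -
    \<comment> \<open>The truncated subtraction is a true one because
      \<open>c i > 0\<close>.\<close>
    have "of_nat ((c(i := c i - 1)) j) = (of_nat (c j) - (if j = i then 1 else 0) :: rat)" for j
      using c by (simp add: of_nat_diff)
    then show ?thesis
      using simple_root_expansion[OF i(1), of 1]
      by (simp only: sum_root_expansion_diff flip: assms(2)) (simp add: scaleQ_one)
  qed
  ultimately show ?thesis
    using that i(1) c by blast
qed

text \<open>Induction on the height of \<beta>: a nonsimple \<beta> is the sum of a simple root and
  a positive root of smaller height, and closedness of \<open>P\<close> relates the three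
  negatives.\<close>

lemma uminus_mem_parabolic_iff:
  assumes P: "standard_parabolic D P"
    and "\<beta> \<in> roots D" "\<beta> = (\<Sum>i\<in>simple_ix D. of_nat (c i) *\<^sub>Q simple_root D i)"
  shows "- \<beta> \<in> P \<longleftrightarrow> (\<forall>i\<in>simple_ix D. c i > 0 \<longrightarrow> - simple_root D i \<in> P)"
  using assms(2-)
proof (induction "\<Sum>i\<in>simple_ix D. c i" arbitrary: \<beta> c rule: less_induct)
  case less
  show ?case
  proof (cases "\<beta> \<in> simple_root D ` simple_ix D")
    case True
    then obtain i where i: "i \<in> simple_ix D" "\<beta> = simple_root D i"
      by auto
    have "of_nat (c j) = (if j = i then 1 else 0 :: rat)" if "j \<in> simple_ix D" for j
      using simple_root_expansion_unique[OF _ that, of "\<lambda>j. of_nat (c j)" "\<lambda>j. if j = i then 1 else 0"]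
        simple_root_expansion[OF i(1), of 1] less.prems i by (simp add: scaleQ_one)
    then have "c j > 0 \<longleftrightarrow> j = i" if "j \<in> simple_ix D" for j
      using that by (metis of_nat_0 of_nat_0_less_iff zero_less_one less_irrefl)
    then show ?thesis
      using i by auto
  next
    case False
    obtain i where i: "i \<in> simple_ix D" "c i > 0" "\<beta> - simple_root D i \<in> roots D"
      "\<beta> - simple_root D i = (\<Sum>j\<in>simple_ix D. of_nat ((c(i := c i - 1)) j) *\<^sub>Q simple_root D j)"
      using positive_root_diff_simple[OF less.prems False] by blast
    have "(\<Sum>j\<in>simple_ix D. (c(i := c i - 1)) j) < (\<Sum>j\<in>simple_ix D. c j)"
      using i finite_simple_ix by (intro sum_strict_mono_ex1) auto
    from less.hyps[OF this i(3,4)]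
    have IH: "- (\<beta> - simple_root D i) \<in> P \<longleftrightarrow>
        (\<forall>j\<in>simple_ix D. (c(i := c i - 1)) j > 0 \<longrightarrow> - simple_root D j \<in> P)" .
    have pos: "\<beta> - simple_root D i \<in> P" "simple_root D i \<in> P"
      using P i(3,4) simple_root_positive[OF i(1)]
      by (auto simp: standard_parabolic_def positive_roots_def)
    \<comment> \<open>The root condition is put on the negative of the sum because in each use that
      negative is one of the positive roots at hand.\<close>
    have closed: "\<gamma> + \<delta> \<in> P" if "\<gamma> \<in> P" "\<delta> \<in> P" "- (\<gamma> + \<delta>) \<in> roots D" for \<gamma> \<delta>
    proof -
      have "\<gamma> + \<delta> \<in> roots D"
        using uminus_root[OF that(3)] by (simp only: minus_minus)
      then show ?thesis
        using P that by (simp add: standard_parabolic_def)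
    qed
    \<comment> \<open>From left to right, adding either positive summand to \<open>- \<beta>\<close>
      leaves the negative of the other one.\<close>
    have "- \<beta> \<in> P \<longleftrightarrow> - (\<beta> - simple_root D i) \<in> P \<and> - simple_root D i \<in> P"
    proof
      assume "- \<beta> \<in> P"
      then show "- (\<beta> - simple_root D i) \<in> P \<and> - simple_root D i \<in> P"
        using closed[of "- \<beta>" "simple_root D i"] closed[of "- \<beta>" "\<beta> - simple_root D i"] pos i(1,3)
          simple_root_in_roots by auto
    next
      assume "- (\<beta> - simple_root D i) \<in> P \<and> - simple_root D i \<in> P"
      then show "- \<beta> \<in> P"
        using closed[of "- (\<beta> - simple_root D i)" "- simple_root D i"] less.prems by auto
    qed
    \<comment> \<open>Lowering \<open>c i\<close> may remove \<open>i\<close> from the support; the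
      separate condition on \<open>- simple_root D i\<close> restores it.\<close>
    then show ?thesis
      unfolding IH using i(1,2) by (auto simp: fun_upd_apply split: if_splits)
  qed
qed

section \<open>Levi subgroups and the parabolics attached to sets of simple roots\<close>

lemma levi_simple_ix_iff:
  "standard_parabolic D P \<Longrightarrow> i \<in> levi_simple_ix D P \<longleftrightarrow> i \<in> simple_ix D \<and> - simple_root D i \<in> P"
  using simple_root_positive by (auto simp: levi_simple_ix_def levi_roots_def standard_parabolic_def)

lemma standard_parabolic_roots: "standard_parabolic D (roots D)"
  by (auto simp: standard_parabolic_def positive_roots_def)

lemma levi_simple_ix_roots: "levi_simple_ix D (roots D) = simple_ix D"
  using levi_simple_ix_iff[OF standard_parabolic_roots] simple_root_in_roots uminus_root by blast

lemma levi_simple_ix_subset: "levi_simple_ix D P \<subseteq> simple_ix D"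
  by (auto simp: levi_simple_ix_def)

text \<open>Either the root or its negative is positive, and by
  \<open>uminus_mem_parabolic_iff\<close> all simple roots in the support of that positive root
  belong to the Levi.\<close>

lemma levi_root_in_span:
  assumes P: "standard_parabolic D P" and "\<beta> \<in> levi_roots P"
  shows "\<beta> \<in> over_rat.span (simple_root D ` levi_simple_ix D P)"
proof -
  have *: "\<gamma> \<in> over_rat.span (simple_root D ` levi_simple_ix D P)"
    if "\<gamma> \<in> positive_roots D" "- \<gamma> \<in> P" for \<gamma>
  proof -
    obtain c where c: "\<gamma> \<in> roots D" "\<gamma> = (\<Sum>i\<in>simple_ix D. of_nat (c i) *\<^sub>Q simple_root D i)"
      using \<open>\<gamma> \<in> positive_roots D\<close> by (auto simp: positive_roots_def)
    have "of_nat (c i) *\<^sub>Q simple_root D i \<in> over_rat.span (simple_root D ` levi_simple_ix D P)"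
      if "i \<in> simple_ix D" for i
    proof (cases "c i = 0")
      case True
      then show ?thesis
        by (simp add: over_rat.span_zero)
    next
      case False
      then have "i \<in> levi_simple_ix D P"
        using uminus_mem_parabolic_iff[OF P c] that \<open>- \<gamma> \<in> P\<close> levi_simple_ix_iff[OF P] by auto
      then show ?thesis
        by (intro over_rat.span_scale over_rat.span_base) auto
    qed
    then show ?thesis
      unfolding c(2) by (rule over_rat.span_sum)
  qed
  have "\<beta> \<in> roots D" "\<beta> \<in> P" "- \<beta> \<in> P"
    using assms by (auto simp: levi_roots_def standard_parabolic_def)
  with positive_or_negative[of \<beta>] show ?thesis
    using *[of \<beta>] *[of "- \<beta>"] over_rat.span_neg by fastforce
qed

text \<open>These are the positive roots together with the negative roots supported in
  \<open>J\<close>. Rational coefficients treat both signs uniformly and make closedness under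
  addition immediate.\<close>

definition parabolic_of :: "'i set \<Rightarrow> 'x set" where
  "parabolic_of J = {\<beta> \<in> roots D. \<exists>d. \<beta> = (\<Sum>i\<in>simple_ix D. d i *\<^sub>Q simple_root D i) \<and>
     (\<forall>i\<in>simple_ix D - J. d i \<ge> 0)}"

lemma standard_parabolic_parabolic_of: "standard_parabolic D (parabolic_of J)"
  unfolding standard_parabolic_def
proof (intro conjI ballI impI)
  show "positive_roots D \<subseteq> parabolic_of J"
  proof
    fix \<beta>
    assume "\<beta> \<in> positive_roots D"
    then obtain c :: "'i \<Rightarrow> nat" where
      "\<beta> \<in> roots D" "\<beta> = (\<Sum>i\<in>simple_ix D. of_nat (c i) *\<^sub>Q simple_root D i)"
      by (auto simp: positive_roots_def)
    then show "\<beta> \<in> parabolic_of J"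
      unfolding parabolic_of_def by (auto intro!: exI[where x = "\<lambda>i. of_nat (c i)"])
  qed
  show "parabolic_of J \<subseteq> roots D"
    by (auto simp: parabolic_of_def)
next
  fix \<alpha> \<beta>
  assume "\<alpha> \<in> parabolic_of J" "\<beta> \<in> parabolic_of J" and root: "\<alpha> + \<beta> \<in> roots D"
  then obtain c d where
    "\<alpha> = (\<Sum>i\<in>simple_ix D. c i *\<^sub>Q simple_root D i)" "\<forall>i\<in>simple_ix D - J. c i \<ge> 0"
    "\<beta> = (\<Sum>i\<in>simple_ix D. d i *\<^sub>Q simple_root D i)" "\<forall>i\<in>simple_ix D - J. d i \<ge> 0"
    by (auto simp: parabolic_of_def)
  then show "\<alpha> + \<beta> \<in> parabolic_of J"
    unfolding parabolic_of_def using root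
    by (auto intro!: exI[where x = "\<lambda>i. c i + d i"] simp: scaleQ_left_distrib sum.distrib)
qed

text \<open>The negative of simple root \<open>i\<close> has the unique coefficient -1 at
  \<open>i\<close>, which is permitted exactly when \<open>i\<close> is in \<open>J\<close>.\<close>

lemma levi_simple_ix_parabolic_of:
  assumes "J \<subseteq> simple_ix D"
  shows "levi_simple_ix D (parabolic_of J) = J"
proof -
  have "- simple_root D i \<in> parabolic_of J \<longleftrightarrow> i \<in> J" if i: "i \<in> simple_ix D" for i
  proof
    assume "- simple_root D i \<in> parabolic_of J"
    then obtain d where d: "- simple_root D i = (\<Sum>i\<in>simple_ix D. d i *\<^sub>Q simple_root D i)"
      "\<forall>i\<in>simple_ix D - J. d i \<ge> 0"
      by (auto simp: parabolic_of_def)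
    have "d i = -1"
      using simple_root_expansion_unique[OF _ i, of d "\<lambda>j. if j = i then -1 else 0"]
        simple_root_expansion[OF i, of "-1"] d(1) by (simp add: scaleQ_one)
    then show "i \<in> J"
      using d(2) i by force
  next
    assume "i \<in> J"
    then show "- simple_root D i \<in> parabolic_of J"
      unfolding parabolic_of_def
      using simple_root_expansion[OF i, of "-1"] uminus_root simple_root_in_roots i
      by (auto intro!: exI[where x = "\<lambda>j. if j = i then -1 else 0"] simp: scaleQ_one)
  qed
  then show ?thesis
    using assms levi_simple_ix_iff[OF standard_parabolic_parabolic_of] by blast
qed

text \<open>This gives the minimality of the parabolic attached to \<open>J\<close>. Positive roots
  lie in every standard parabolic; a negative root in \<open>parabolic_of J\<close> is supported in
  \<open>J\<close>, so \<open>uminus_mem_parabolic_iff\<close> applies to its negative.\<close>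

lemma parabolic_of_subset:
  assumes P: "standard_parabolic D P" and J: "J \<subseteq> levi_simple_ix D P"
  shows "parabolic_of J \<subseteq> P"
proof
  fix \<beta>
  assume "\<beta> \<in> parabolic_of J"
  then obtain d where d: "\<beta> \<in> roots D" "\<beta> = (\<Sum>i\<in>simple_ix D. d i *\<^sub>Q simple_root D i)"
    "\<forall>i\<in>simple_ix D - J. d i \<ge> 0"
    by (auto simp: parabolic_of_def)
  show "\<beta> \<in> P"
  proof (cases "\<beta> \<in> positive_roots D")
    case True
    then show ?thesis
      using P by (auto simp: standard_parabolic_def)
  next
    case False
    then obtain c :: "'i \<Rightarrow> nat" where
      c: "- \<beta> \<in> roots D" "- \<beta> = (\<Sum>i\<in>simple_ix D. of_nat (c i) *\<^sub>Q simple_root D i)"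
      using positive_or_negative[OF d(1)] by (auto simp: positive_roots_def)
    have "\<beta> = (\<Sum>i\<in>simple_ix D. (- of_nat (c i)) *\<^sub>Q simple_root D i)"
      using c(2) by (simp add: sum_negf) (metis minus_minus)
    then have "d i = - of_nat (c i)" if "i \<in> simple_ix D" for i
      using simple_root_expansion_unique[OF _ that] d(2) by metis
    then have "i \<in> J" if "i \<in> simple_ix D" "c i > 0" for i
      using d(3) that by force
    then show ?thesis
      using uminus_mem_parabolic_iff[OF P c] J levi_simple_ix_iff[OF P] by auto
  qed
qed

section \<open>The slope map\<close>

text \<open>Nondegeneracy of the Cartan matrix of a Levi. The combination \<open>v\<close> has
  \<open>form v v = 0\<close>, hence lies in the radical. Since the form against \<open>v\<close> is
  the pairing with a rescaled combination \<open>x\<close> of simple roots, \<open>x\<close>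
  vanishes, and so do its coefficients.\<close>

lemma simple_coroot_orthogonal_zero:
  assumes "K \<subseteq> simple_ix D"
    and orth: "\<And>k. k \<in> K \<Longrightarrow> pairing D (\<Sum>j\<in>K. c j *\<^sub>Q simple_coroot D j) (simple_root D k) = 0"
    and "j \<in> K"
  shows "c j = 0"
proof -
  define v where "v = (\<Sum>j\<in>K. c j *\<^sub>Q simple_coroot D j)"
  \<comment> \<open>The factor relating form and pairing in \<open>form_coroot\<close>.\<close>
  define m where "m j = form (simple_coroot D j) (simple_coroot D j) / 2" for j
  \<comment> \<open>Padding by zeros allows comparison of coefficients over all simple
    roots.\<close>
  define x where "x = (\<Sum>j\<in>simple_ix D. (if j \<in> K then c j * m j else 0) *\<^sub>Q simple_root D j)"
  have x: "x = (\<Sum>j\<in>K. (c j * m j) *\<^sub>Q simple_root D j)"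
    unfolding x_def using finite_simple_ix assms(1) by (intro sum.mono_neutral_cong_right) auto
  have form_v: "form v y = pairing D y x" for y
    unfolding v_def x form_sum_left pairing_right
    using form_coroot[OF simple_root_in_roots] assms(1)
    by (intro sum.cong) (auto simp: m_def simple_coroot_def)
  have "form v v = 0"
    unfolding form_v x pairing_right using orth by (auto simp: v_def)
  then have "pairing D v \<gamma> = 0" if "\<gamma> \<in> roots D" for \<gamma>
    using form_zero_pairing_root that by blast
  then have "form v y = 0" for y
    by (simp add: form_def)
  then have "x = 0"
    using form_v pairing_nondegenerate by simp
  then have "(if j \<in> K then c j * m j else 0) = 0"
    using simple_root_expansion_unique[of "\<lambda>j. if j \<in> K then c j * m j else 0" "\<lambda>_. 0" j]
      assms(1,3) unfolding x_def by auto
  moreover have "m j > 0"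
    using form_coroot_pos[OF simple_root_in_roots] assms(1,3) by (auto simp: m_def simple_coroot_def)
  ultimately show ?thesis
    using assms(3) by simp
qed

text \<open>A Gram-Schmidt argument. It shows that the central directions of the Levi surject onto
  the quotient by its coroot space.\<close>

lemma coroot_span_projection:
  assumes "K \<subseteq> simple_ix D"
  shows "\<exists>u\<in>over_rat.span (simple_coroot D ` K). \<forall>k\<in>K. pairing D (y - u) (simple_root D k) = 0"
proof -
  have "finite K"
    using assms finite_simple_ix finite_subset by blast
  then show ?thesis
    using assms
  proof (induction K arbitrary: y rule: finite_induct)
    case empty
    then show ?case
      by (auto simp: over_rat.span_zero)
  next
    case (insert k K)
    let ?V = "over_rat.span (simple_coroot D ` insert k K)"
    have V: "over_rat.span (simple_coroot D ` K) \<subseteq> ?V" "simple_coroot D k \<in> ?V"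
      by (auto intro!: over_rat.span_mono intro: over_rat.span_base)
    obtain u where u: "u \<in> over_rat.span (simple_coroot D ` K)"
      "\<forall>j\<in>K. pairing D (y - u) (simple_root D j) = 0"
      using insert by blast
    obtain w where w: "w \<in> over_rat.span (simple_coroot D ` K)"
      "\<forall>j\<in>K. pairing D (simple_coroot D k - w) (simple_root D j) = 0"
      using insert by blast
    define n where "n = simple_coroot D k - w"
    obtain c where c: "w = (\<Sum>j\<in>K. c j *\<^sub>Q simple_coroot D j)"
      using w(1) over_rat.span_image_finite[OF insert.hyps(1)] by blast
    \<comment> \<open>The coefficient 1 at \<open>k\<close> is what contradicts
      \<open>simple_coroot_orthogonal_zero\<close> below.\<close>
    have n: "n = (\<Sum>j\<in>insert k K. (if j = k then 1 else - c j) *\<^sub>Q simple_coroot D j)"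
      unfolding n_def c using insert.hyps
      by (auto simp: scaleQ_one sum_negf intro!: sum.cong
          simp flip: sum_negf over_rat.scale_minus_left)
    have nk: "pairing D n (simple_root D k) \<noteq> 0"
    proof
      assume "pairing D n (simple_root D k) = 0"
      then have "pairing D n (simple_root D j) = 0" if "j \<in> insert k K" for j
        using w(2) that by (auto simp: n_def)
      from simple_coroot_orthogonal_zero[OF insert.prems this[unfolded n], of k] show False
        by simp
    qed
    \<comment> \<open>Chosen to cancel the remaining pairing with simple root \<open>k\<close>;
      adding \<open>t *\<^sub>Q n\<close> leaves the pairings with the earlier simple roots
      unchanged.\<close>
    define t where "t = pairing D (y - u) (simple_root D k) / pairing D n (simple_root D k)"
    have "u + t *\<^sub>Q n \<in> ?V"
      using u(1) w(1) V unfolding n_def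
      by (intro over_rat.span_add over_rat.span_scale over_rat.span_diff) auto
    moreover have "pairing D (y - (u + t *\<^sub>Q n)) (simple_root D j) = 0" if "j \<in> insert k K" for j
    proof (cases "j = k")
      case True
      then show ?thesis
        using nk by (simp add: pairing_left t_def)
    next
      case False
      with that u(2) w(2) have "pairing D (y - u) (simple_root D j) = 0" "pairing D n (simple_root D j) = 0"
        by (auto simp: n_def)
      then show ?thesis
        by (simp add: pairing_left)
    qed
    ultimately show ?case
      by blast
  qed
qed

text \<open>Vanishing on the simple roots of the Levi implies vanishing on all its roots by
  \<open>levi_root_in_span\<close>; clearing denominators then produces a genuine central
  cocharacter.\<close>

lemma span_center_cochars:
  assumes P: "standard_parabolic D P"
  shows "over_rat.span (center_cochars D P)
    = {v. \<forall>i\<in>levi_simple_ix D P. pairing D v (simple_root D i) = 0}"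
proof
  show "over_rat.span (center_cochars D P)
      \<subseteq> {v. \<forall>i\<in>levi_simple_ix D P. pairing D v (simple_root D i) = 0}"
    by (rule over_rat.span_minimal)
      (auto intro!: over_rat.subspaceI simp: pairing_left center_cochars_def levi_simple_ix_def)
next
  show "{v. \<forall>i\<in>levi_simple_ix D P. pairing D v (simple_root D i) = 0}
      \<subseteq> over_rat.span (center_cochars D P)"
  proof
    fix v
    assume v: "v \<in> {v. \<forall>i\<in>levi_simple_ix D P. pairing D v (simple_root D i) = 0}"
    have "over_rat.subspace {x. pairing D v x = 0}"
      by (auto intro!: over_rat.subspaceI simp: pairing_right)
    then have "over_rat.span (simple_root D ` levi_simple_ix D P) \<subseteq> {x. pairing D v x = 0}"
      using v by (intro over_rat.span_minimal) auto
    then have orth: "pairing D v \<alpha> = 0" if "\<alpha> \<in> levi_roots P" for \<alpha>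
      using levi_root_in_span[OF P that] by auto
    obtain N where N: "N \<noteq> 0" "N *\<^sub>Q v \<in> cochars D"
      using full_lattice_multiple[OF full_lattice_cochars] .
    then have "N *\<^sub>Q v \<in> center_cochars D P"
      by (simp add: center_cochars_def pairing_left orth)
    then have "inverse N *\<^sub>Q N *\<^sub>Q v \<in> over_rat.span (center_cochars D P)"
      by (intro over_rat.span_scale over_rat.span_base)
    then show "v \<in> over_rat.span (center_cochars D P)"
      using N by (simp add: scaleQ_one)
  qed
qed

text \<open>The injectivity half of the isomorphism inverted by \<open>slope\<close>.\<close>

lemma coroot_space_inter_center:
  assumes "v \<in> levi_coroot_space D P"
    and "\<forall>i\<in>levi_simple_ix D P. pairing D v (simple_root D i) = 0"
  shows "v = 0"
proof -
  have fin: "finite (levi_simple_ix D P)"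
    using finite_simple_ix levi_simple_ix_subset finite_subset by blast
  obtain c where c: "v = (\<Sum>j\<in>levi_simple_ix D P. c j *\<^sub>Q simple_coroot D j)"
    using assms(1) over_rat.span_image_finite[OF fin] unfolding levi_coroot_space_def by blast
  then have "c j = 0" if "j \<in> levi_simple_ix D P" for j
    using simple_coroot_orthogonal_zero[OF levi_simple_ix_subset _ that] assms(2) by blast
  then show ?thesis
    unfolding c by simp
qed

lemma subspace_levi_coroot_lattice: "over_int.subspace (levi_coroot_lattice D P)"
  by (simp add: levi_coroot_lattice_def)

lemma subspace_levi_coroot_space: "over_rat.subspace (levi_coroot_space D P)"
  by (simp add: levi_coroot_space_def)

text \<open>Replaces the inverse map by linear conditions: the slope is the unique central vector
  congruent to \<open>y\<close> modulo the coroot space. Existence comes from the projection,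
  uniqueness from the trivial intersection.\<close>

lemma slope_degree_class_iff:
  assumes P: "standard_parabolic D P"
  shows "slope D P (degree_class D P y) = v \<longleftrightarrow>
    (\<forall>i\<in>levi_simple_ix D P. pairing D v (simple_root D i) = 0) \<and> v - y \<in> levi_coroot_space D P"
proof -
  let ?V = "levi_coroot_space D P" and ?Z = "over_rat.span (center_cochars D P)"
  note V = int_subspace_if_rat_subspace[OF subspace_levi_coroot_space, of P]
  have "degree_class D P y + ?V = y +o ?V"
    unfolding degree_class_def using subspace_levi_coroot_lattice V int_span_subset_rat_span
    by (intro coset_plus_subspace) (auto simp: levi_coroot_lattice_def levi_coroot_space_def)
  then have slope: "slope D P (degree_class D P y) = inv_into ?Z (\<lambda>v. v +o ?V) (y +o ?V)"
    by (simp add: slope_def)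
  have inj: "inj_on (\<lambda>v. v +o ?V) ?Z"
  proof (rule inj_onI)
    fix a b
    assume "a \<in> ?Z" "b \<in> ?Z" "a +o ?V = b +o ?V"
    then have "a - b \<in> ?V" "\<forall>i\<in>levi_simple_ix D P. pairing D (a - b) (simple_root D i) = 0"
      using V by (auto simp: coset_eq_iff span_center_cochars[OF P] pairing_left)
    then show "a = b"
      using coroot_space_inter_center[of "a - b" P] by simp
  qed
  obtain u where u: "u \<in> ?V" "\<forall>i\<in>levi_simple_ix D P. pairing D (y - u) (simple_root D i) = 0"
    using coroot_span_projection[OF levi_simple_ix_subset] unfolding levi_coroot_space_def by blast
  then have "y - u \<in> ?Z"
    by (simp add: span_center_cochars[OF P])
  moreover have "(y - u) +o ?V = y +o ?V"
    using u(1) over_int.subspace_neg[OF V] V by (simp add: coset_eq_iff)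
  \<comment> \<open>The preimage \<open>y - u\<close> ensures that \<open>inv_into\<close> returns a
    true preimage and not an arbitrary value.\<close>
  ultimately have mem: "y +o ?V \<in> (\<lambda>v. v +o ?V) ` ?Z"
    by (metis image_eqI)
  have "inv_into ?Z (\<lambda>v. v +o ?V) (y +o ?V) = v \<longleftrightarrow> v \<in> ?Z \<and> v +o ?V = y +o ?V"
    using inv_into_into[OF mem] f_inv_into_f[OF mem] inv_into_f_f[OF inj] by metis
  then show ?thesis
    using V by (simp add: slope coset_eq_iff span_center_cochars[OF P])
qed

lemma levi_coroot_lattice_mono:
  "levi_simple_ix D P \<subseteq> levi_simple_ix D Q \<Longrightarrow> levi_coroot_lattice D P \<subseteq> levi_coroot_lattice D Q"
  unfolding levi_coroot_lattice_def by (intro over_int.span_mono) auto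

lemma degree_proj_degree_class:
  "degree_proj D (degree_class D P y) = degree_class D (roots D) y"
  unfolding degree_proj_def degree_class_def
  by (intro coset_plus_subspace subspace_levi_coroot_lattice levi_coroot_lattice_mono)
    (simp add: levi_simple_ix_roots levi_simple_ix_subset)

lemma degree_class_eq_iff: "degree_class D P y = degree_class D P z \<longleftrightarrow> y - z \<in> levi_coroot_lattice D P"
  unfolding degree_class_def by (rule coset_eq_iff[OF subspace_levi_coroot_lattice])

end

section \<open>Coordinates with respect to the simple coroots\<close>

text \<open>Each weight is fixed only up to vectors orthogonal to all simple coroots; coordinates of
  vectors in the coroot span do not depend on this choice.\<close>

locale root_datum_with_weights = based_root_datum D
  for D :: "('x::rat_vector, 'y::rat_vector, 'i) root_datum" +
  fixes \<omega> :: "'i \<Rightarrow> 'x"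
  assumes pairing_weight: "i \<in> simple_ix D \<Longrightarrow> j \<in> simple_ix D \<Longrightarrow>
    pairing D (simple_coroot D j) (\<omega> i) = (if i = j then 1 else 0)"
begin

lemma pairing_coroot_sum_weight:
  assumes "K \<subseteq> simple_ix D" "i \<in> simple_ix D"
  shows "pairing D (\<Sum>k\<in>K. c k *\<^sub>Q simple_coroot D k) (\<omega> i) = (if i \<in> K then c i else 0)"
proof -
  have "finite K"
    using assms(1) finite_simple_ix finite_subset by blast
  have "pairing D (\<Sum>k\<in>K. c k *\<^sub>Q simple_coroot D k) (\<omega> i) = (\<Sum>k\<in>K. if k = i then c k else 0)"
    unfolding pairing_left using assms by (intro sum.cong) (auto simp: pairing_weight)
  then show ?thesis
    using \<open>finite K\<close> by simp
qed

text \<open>The weights are dual to the simple coroots and read off the coefficients, so membership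
  becomes an equation.\<close>

lemma coroot_space_iff:
  "v \<in> levi_coroot_space D P \<longleftrightarrow>
    v = (\<Sum>i\<in>levi_simple_ix D P. pairing D v (\<omega> i) *\<^sub>Q simple_coroot D i)"
    (is "_ \<longleftrightarrow> v = ?s")
proof
  have fin: "finite (levi_simple_ix D P)"
    using finite_simple_ix levi_simple_ix_subset finite_subset by blast
  assume "v \<in> levi_coroot_space D P"
  then obtain c where c: "v = (\<Sum>i\<in>levi_simple_ix D P. c i *\<^sub>Q simple_coroot D i)"
    unfolding levi_coroot_space_def over_rat.span_image_finite[OF fin] by blast
  have "pairing D v (\<omega> i) = c i" if "i \<in> levi_simple_ix D P" for i
    using pairing_coroot_sum_weight[OF levi_simple_ix_subset] levi_simple_ix_subset that
    unfolding c by force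
  then show "v = ?s"
    using c by simp
next
  have "?s \<in> levi_coroot_space D P"
    unfolding levi_coroot_space_def
    by (intro over_rat.span_sum over_rat.span_scale over_rat.span_base) auto
  then show "v \<in> levi_coroot_space D P" if "v = ?s"
    using that by simp
qed

text \<open>Testing integrality at all simple indices shows that the full coroot lattice meets the
  coroot space of a Levi exactly in the coroot lattice of that Levi.\<close>

lemma coroot_lattice_iff:
  "v \<in> levi_coroot_lattice D P \<longleftrightarrow>
    v \<in> levi_coroot_space D P \<and> (\<forall>i\<in>simple_ix D. pairing D v (\<omega> i) \<in> \<int>)"
proof
  have fin: "finite (levi_simple_ix D P)"
    using finite_simple_ix levi_simple_ix_subset finite_subset by blast
  assume v: "v \<in> levi_coroot_lattice D P"
  then obtain c :: "'i \<Rightarrow> int" where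
    c: "v = (\<Sum>i\<in>levi_simple_ix D P. of_int (c i) *\<^sub>Q simple_coroot D i)"
    unfolding levi_coroot_lattice_def over_int.span_image_finite[OF fin] by blast
  have "pairing D v (\<omega> i) \<in> \<int>" if "i \<in> simple_ix D" for i
    unfolding c pairing_coroot_sum_weight[OF levi_simple_ix_subset that] by simp
  then show "v \<in> levi_coroot_space D P \<and> (\<forall>i\<in>simple_ix D. pairing D v (\<omega> i) \<in> \<int>)"
    using v int_span_subset_rat_span unfolding levi_coroot_lattice_def levi_coroot_space_def by blast
next
  assume v: "v \<in> levi_coroot_space D P \<and> (\<forall>i\<in>simple_ix D. pairing D v (\<omega> i) \<in> \<int>)"
  have "pairing D v (\<omega> i) *\<^sub>Q simple_coroot D i \<in> levi_coroot_lattice D P"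
    if i: "i \<in> levi_simple_ix D P" for i
  proof -
    obtain n :: int where "pairing D v (\<omega> i) = of_int n"
      using v i levi_simple_ix_subset by (meson Ints_cases subsetD)
    then show ?thesis
      using i unfolding levi_coroot_lattice_def
      by (auto intro: over_int.span_scale over_int.span_base)
  qed
  then have "(\<Sum>i\<in>levi_simple_ix D P. pairing D v (\<omega> i) *\<^sub>Q simple_coroot D i) \<in> levi_coroot_lattice D P"
    unfolding levi_coroot_lattice_def by (rule over_int.span_sum)
  then show "v \<in> levi_coroot_lattice D P"
    using v coroot_space_iff by metis
qed

lemma pairing_weight_outside_levi:
  assumes "v \<in> levi_coroot_space D P" "i \<in> simple_ix D" "i \<notin> levi_simple_ix D P"
  shows "pairing D v (\<omega> i) = 0"
  using assms pairing_coroot_sum_weight[OF levi_simple_ix_subset assms(2)] coroot_space_iff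
  by metis

section \<open>Degrees with prescribed slope and projection\<close>

lemma simple_coroot_in_cochars: "i \<in> simple_ix D \<Longrightarrow> simple_coroot D i \<in> cochars D"
  using coroot_in_cochars simple_root_in_roots by (simp add: simple_coroot_def)

lemma subspace_cochars: "over_int.subspace (cochars D)"
  using full_lattice_cochars by (auto simp: full_lattice_def)

lemma levi_coroot_lattice_subset_cochars: "levi_coroot_lattice D P \<subseteq> cochars D"
  unfolding levi_coroot_lattice_def
  using subspace_cochars simple_coroot_in_cochars levi_simple_ix_subset
  by (intro over_int.span_minimal) auto

text \<open>The slope for \<open>G\<close> is orthogonal to all simple roots, hence central for
  every Levi, so only the congruence modulo the coroot space remains to be imposed.\<close>

lemma degree_with_slope_iff:
  assumes P: "standard_parabolic D P" and \<phi>: "\<phi> = slope D (roots D) (degree_class D (roots D) \<nu>)"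
  shows "\<phi> = slope D P (degree_class D P \<mu>) \<and>
      degree_proj D (degree_class D P \<mu>) = degree_class D (roots D) \<nu> \<longleftrightarrow>
    \<phi> - \<mu> \<in> levi_coroot_space D P \<and> \<mu> - \<nu> \<in> levi_coroot_lattice D (roots D)"
proof -
  have "\<forall>i\<in>simple_ix D. pairing D \<phi> (simple_root D i) = 0"
    using slope_degree_class_iff[OF standard_parabolic_roots, of \<nu> \<phi>] \<phi> by (simp add: levi_simple_ix_roots)
  then have "\<forall>i\<in>levi_simple_ix D P. pairing D \<phi> (simple_root D i) = 0"
    using levi_simple_ix_subset by blast
  then show ?thesis
    using slope_degree_class_iff[OF P, of \<mu> \<phi>] by (auto simp: degree_proj_degree_class degree_class_eq_iff)
qed

lemma slope_diff_in_coroot_space: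
  "slope D (roots D) (degree_class D (roots D) \<nu>) - \<nu> \<in> levi_coroot_space D (roots D)"
  using slope_degree_class_iff[OF standard_parabolic_roots] by blast

text \<open>The difference of the two lifts lies in the full coroot lattice and in the coroot space
  of the Levi, hence in the coroot lattice of the Levi.\<close>

lemma degree_with_slope_unique:
  assumes "\<phi> - \<mu> \<in> levi_coroot_space D P" "\<mu> - \<nu> \<in> levi_coroot_lattice D (roots D)"
    and "\<phi> - \<mu>' \<in> levi_coroot_space D P" "\<mu>' - \<nu> \<in> levi_coroot_lattice D (roots D)"
  shows "degree_class D P \<mu> = degree_class D P \<mu>'"
proof -
  have "(\<mu> - \<nu>) - (\<mu>' - \<nu>) \<in> levi_coroot_lattice D (roots D)"
    using assms over_int.subspace_diff[OF subspace_levi_coroot_lattice] by blast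
  moreover have "(\<phi> - \<mu>') - (\<phi> - \<mu>) \<in> levi_coroot_space D P"
    using assms over_rat.subspace_diff[OF subspace_levi_coroot_space] by blast
  ultimately show ?thesis
    by (simp add: degree_class_eq_iff coroot_lattice_iff)
qed

text \<open>Outside the Levi the coordinates of \<phi> - \<mu> vanish, and those of \<mu> - \<nu>
  are integral everywhere.\<close>

lemma nonintegral_subset_levi:
  assumes "\<phi> - \<mu> \<in> levi_coroot_space D P" "\<mu> - \<nu> \<in> levi_coroot_lattice D (roots D)"
  shows "{i \<in> simple_ix D. pairing D (\<phi> - \<nu>) (\<omega> i) \<notin> \<int>} \<subseteq> levi_simple_ix D P"
proof
  fix i
  assume i: "i \<in> {i \<in> simple_ix D. pairing D (\<phi> - \<nu>) (\<omega> i) \<notin> \<int>}"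
  have "pairing D (\<phi> - \<nu>) (\<omega> i) = pairing D (\<phi> - \<mu>) (\<omega> i) + pairing D (\<mu> - \<nu>) (\<omega> i)"
    by (simp add: pairing_left)
  moreover have "pairing D (\<mu> - \<nu>) (\<omega> i) \<in> \<int>"
    using assms(2) i coroot_lattice_iff by blast
  ultimately have "pairing D (\<phi> - \<mu>) (\<omega> i) \<noteq> 0"
    using i by auto
  then show "i \<in> levi_simple_ix D P"
    using pairing_weight_outside_levi[OF assms(1)] i by blast
qed

lemma degree_with_slope_exists:
  assumes \<nu>: "\<nu> \<in> cochars D" and \<phi>: "\<phi> - \<nu> \<in> levi_coroot_space D (roots D)"
    and "{i \<in> simple_ix D. pairing D (\<phi> - \<nu>) (\<omega> i) \<notin> \<int>} \<subseteq> levi_simple_ix D P"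
  obtains \<mu> where "\<mu> \<in> cochars D" "\<phi> - \<mu> \<in> levi_coroot_space D P"
    "\<mu> - \<nu> \<in> levi_coroot_lattice D (roots D)"
proof -
  let ?f = "\<lambda>i. pairing D (\<phi> - \<nu>) (\<omega> i) *\<^sub>Q simple_coroot D i"
  let ?J = "levi_simple_ix D P"
  have fin: "finite (simple_ix D)" "?J \<subseteq> simple_ix D"
    using finite_simple_ix levi_simple_ix_subset by auto
  \<comment> \<open>The part of \<phi> - \<nu> outside the Levi has integral coordinates by
    assumption; moving it into the lift gives \<mu> = \<nu> + \<open>h\<close>.\<close>
  define h where "h = (\<Sum>i\<in>simple_ix D - ?J. ?f i)"
  have h: "h \<in> levi_coroot_lattice D (roots D)"
    unfolding h_def levi_coroot_lattice_def
  proof (rule over_int.span_sum)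
    fix i
    assume i: "i \<in> simple_ix D - ?J"
    then obtain n :: int where "pairing D (\<phi> - \<nu>) (\<omega> i) = of_int n"
      using assms(3) by (auto elim!: Ints_cases)
    then show "?f i \<in> over_int.span (simple_coroot D ` levi_simple_ix D (roots D))"
      using i by (auto simp: levi_simple_ix_roots intro: over_int.span_scale over_int.span_base)
  qed
  have "\<phi> - \<nu> = (\<Sum>i\<in>simple_ix D. ?f i)"
    using \<phi> coroot_space_iff[of "\<phi> - \<nu>" "roots D"] by (simp add: levi_simple_ix_roots)
  also have "\<dots> = h + (\<Sum>i\<in>?J. ?f i)"
    unfolding h_def using fin by (intro sum.subset_diff)
  finally have "\<phi> - (\<nu> + h) = (\<Sum>i\<in>?J. ?f i)"
    by (simp add: algebra_simps)
  moreover have "(\<Sum>i\<in>?J. ?f i) \<in> levi_coroot_space D P"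
    unfolding levi_coroot_space_def
    by (intro over_rat.span_sum over_rat.span_scale over_rat.span_base) auto
  moreover have "\<nu> + h \<in> cochars D"
    using \<nu> h levi_coroot_lattice_subset_cochars over_int.subspace_add[OF subspace_cochars] by blast
  ultimately show ?thesis
    using that[of "\<nu> + h"] h by simp
qed

end

section \<open>The smallest parabolic and its unique degree\<close>

theorem lemma2p12:
  fixes D :: "('x::rat_vector, 'y::rat_vector, 'i) root_datum"
    and \<omega> :: "'i \<Rightarrow> 'x"
    and lam\<^sub>G :: "'y set"
  assumes "based_root_datum D"
    and "\<And>i j. i \<in> simple_ix D \<Longrightarrow> j \<in> simple_ix D \<Longrightarrow>
           pairing D (simple_coroot D j) (\<omega> i) = (if i = j then 1 else 0)"
    and "lam\<^sub>G \<in> degrees D (roots D)"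
  shows "\<exists>P. standard_parabolic D P \<and>
      (\<exists>!lam\<^sub>P. lam\<^sub>P \<in> degrees D P \<and> slope D (roots D) lam\<^sub>G = slope D P lam\<^sub>P \<and> degree_proj D lam\<^sub>P = lam\<^sub>G) \<and>
      (\<forall>P'. standard_parabolic D P' \<and>
            (\<exists>lam\<^sub>P\<in>degrees D P'. slope D (roots D) lam\<^sub>G = slope D P' lam\<^sub>P \<and> degree_proj D lam\<^sub>P = lam\<^sub>G) \<longrightarrow>
            P \<subseteq> P') \<and>
      (\<forall>lam\<in>cochars D. degree_class D (roots D) lam = lam\<^sub>G \<longrightarrow>
         levi_simple_ix D P = {i \<in> simple_ix D. pairing D (slope D (roots D) lam\<^sub>G - lam) (\<omega> i) \<notin> \<int>})"
proof -
  interpret root_datum_with_weights D \<omega>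
    using assms(1,2) by (simp add: root_datum_with_weights_def root_datum_with_weights_axioms_def)
  define \<phi> where "\<phi> = slope D (roots D) lam\<^sub>G"
  obtain \<nu> where \<nu>: "\<nu> \<in> cochars D" "lam\<^sub>G = degree_class D (roots D) \<nu>"
    using assms(3) by (auto simp: degrees_def)
  \<comment> \<open>The lift is a parameter because the last claim concerns every lift, while
    \<open>P\<close> is built from the chosen \<nu>.\<close>
  define J where "J l = {i \<in> simple_ix D. pairing D (\<phi> - l) (\<omega> i) \<notin> \<int>}" for l
  define P where "P = parabolic_of (J \<nu>)"
  have P: "standard_parabolic D P" and JP: "levi_simple_ix D P = J \<nu>"
    unfolding P_def
    by (simp_all add: standard_parabolic_parabolic_of levi_simple_ix_parabolic_of J_def)
  have \<phi>: "\<phi> - l \<in> levi_coroot_space D (roots D)" if "lam\<^sub>G = degree_class D (roots D) l" for l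
    unfolding \<phi>_def that by (rule slope_diff_in_coroot_space)
  have iff: "\<phi> = slope D Q (degree_class D Q \<mu>) \<and> degree_proj D (degree_class D Q \<mu>) = lam\<^sub>G \<longleftrightarrow>
      \<phi> - \<mu> \<in> levi_coroot_space D Q \<and> \<mu> - \<nu> \<in> levi_coroot_lattice D (roots D)"
    if "standard_parabolic D Q" for Q \<mu>
    using degree_with_slope_iff[OF that] by (simp add: \<phi>_def \<nu>(2))
  obtain \<mu> where \<mu>: "\<mu> \<in> cochars D" "\<phi> - \<mu> \<in> levi_coroot_space D P"
    "\<mu> - \<nu> \<in> levi_coroot_lattice D (roots D)"
    using degree_with_slope_exists[OF \<nu>(1) \<phi>[OF \<nu>(2)], of P] JP by (auto simp: J_def)
  have "\<exists>!lam\<^sub>P. lam\<^sub>P \<in> degrees D P \<and> \<phi> = slope D P lam\<^sub>P \<and> degree_proj D lam\<^sub>P = lam\<^sub>G"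
  proof (rule ex1I)
    show "degree_class D P \<mu> \<in> degrees D P \<and> \<phi> = slope D P (degree_class D P \<mu>) \<and>
        degree_proj D (degree_class D P \<mu>) = lam\<^sub>G"
      using iff[OF P] \<mu> by (auto simp: degrees_def)
  next
    fix C
    assume C: "C \<in> degrees D P \<and> \<phi> = slope D P C \<and> degree_proj D C = lam\<^sub>G"
    then obtain \<mu>' where "C = degree_class D P \<mu>'"
      by (auto simp: degrees_def)
    with C show "C = degree_class D P \<mu>"
      using iff[OF P, of \<mu>'] \<mu> degree_with_slope_unique by blast
  qed
  moreover have "P \<subseteq> P'" if P': "standard_parabolic D P'"
    and C: "C \<in> degrees D P'" "\<phi> = slope D P' C" "degree_proj D C = lam\<^sub>G" for P' C
  proof -
    obtain \<mu>' where "C = degree_class D P' \<mu>'"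
      using C by (auto simp: degrees_def)
    then have "J \<nu> \<subseteq> levi_simple_ix D P'"
      using iff[OF P', of \<mu>'] C nonintegral_subset_levi unfolding J_def by blast
    then show ?thesis
      unfolding P_def by (rule parabolic_of_subset[OF P'])
  qed
  \<comment> \<open>Two lifts differ by an element of the coroot lattice, whose coordinates are
    integral, so the nonintegral indices agree.\<close>
  moreover have "levi_simple_ix D P = J l" if "degree_class D (roots D) l = lam\<^sub>G" for l
  proof -
    have l: "l - \<nu> \<in> levi_coroot_lattice D (roots D)"
      using that by (simp add: \<nu>(2) degree_class_eq_iff)
    have "pairing D (\<phi> - \<nu>) (\<omega> i) \<in> \<int> \<longleftrightarrow> pairing D (\<phi> - l) (\<omega> i) \<in> \<int>" if "i \<in> simple_ix D" for i
    proof -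
      have "pairing D (l - \<nu>) (\<omega> i) \<in> \<int>"
        using l that coroot_lattice_iff by blast
      moreover have "pairing D (\<phi> - \<nu>) (\<omega> i) = pairing D (\<phi> - l) (\<omega> i) + pairing D (l - \<nu>) (\<omega> i)"
        by (simp add: pairing_left)
      ultimately show ?thesis
        by (metis Ints_add Ints_diff add_diff_cancel_right')
    qed
    then show ?thesis
      unfolding JP J_def by blast
  qed
  ultimately show ?thesis
    unfolding \<phi>_def[symmetric] J_def by (intro exI[where x = P] conjI allI impI ballI P) auto
qed

end
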